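(* Let $p$ be an odd prime. Then $\sup_{j\in\mathbb{F}_p^\times}\Lambda_{S_j}(\vartheta)\ge\Lambda_\flat(\vartheta)$ for all $0\le\vartheta\le4$, where $$\Lambda_\flat(\vartheta)=\begin{cases}0,&0\le\vartheta<2,\\ \frac{\vartheta-2}{2},&2\le\vartheta\le3,\\ \frac12,&3<\vartheta\le4.\end{cases}$$
   Context: Let $\chi(y)=e^{2\pi i y/p}$ on $\mathbb{F}_p$, $Q_4(x)=x_1^2+\dots+x_4^2$, and for $j\in\mathbb{F}_p^\times$ let $S_j=\{x\in\mathbb{F}_p^4:Q_4(x)=j\}$ with uniform probability measure $d\sigma_j$, so $\|f\|_{L^2(S_j,d\sigma_j)}=\big(\frac1{|S_j|}\sum_{\xi\in S_j}|f(\xi)|^2\big)^{1/2}$. Let $(f\,d\sigma_j)^\vee(x)=\frac1{|S_j|}\sum_{y\in S_j}f(y)\chi(y\cdot x)$, and let $L^2(E)$ use counting measure. For $0\le\vartheta\le4$, $\Lambda_{S_j}(\vartheta)$ is the infimum of all $\lambda\ge0$ such that for every $E\subseteq\mathbb{F}_p^4$ with $1\le|E|\le p^\vartheta$ and every $f:S_j\to\mathbb{C}$, $\|(f\,d\sigma_j)^\vee\|_{L^2(E)}\le p^\lambda\|f\|_{L^2(S_j,d\sigma_j)}$. Equivalently (by duality), it is the infimum of $\lambda\ge0$ such that for every such $E$ and every $g:\mathbb{F}_p^4\to\mathbb{C}$ supported on $E$, $\|\widehat g\|_{L^2(S_j,d\sigma_j)}\le p^\lambda\|g\|_{L^2(\mathbb{F}_p^4)}$,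 where $\widehat g(\xi)=\sum_x g(x)\chi(-x\cdot\xi)$ and $L^2(\mathbb{F}_p^4)$ uses counting measure. *)

theory Defs
  imports "HOL-Analysis.Analysis" "Berlekamp_Zassenhaus.Finite_Field"
begin

text \<open>
  The prime field with \<open>p\<close> elements is \<open>'p mod_ring\<close>, where \<open>'p\<close> is a type of class
  \<open>prime_card\<close> and \<open>p = CARD('p)\<close>.
\<close>

type_synonym 'p F4 = "('p mod_ring)^4"

definition chi :: "'p::prime_card mod_ring \<Rightarrow> complex" where
  "chi y = exp (2 * complex_of_real pi * \<i> * of_int (to_int_mod_ring y) / of_nat CARD('p))"

definition dotp :: "'p::prime_card F4 \<Rightarrow> 'p F4 \<Rightarrow> 'p mod_ring" where
  "dotp y x = (\<Sum>i\<in>UNIV. y $ i * x $ i)"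

definition Q4 :: "'p::prime_card F4 \<Rightarrow> 'p mod_ring" where
  "Q4 x = (\<Sum>i\<in>UNIV. (x $ i)\<^sup>2)"

definition sphere4 :: "'p::prime_card mod_ring \<Rightarrow> 'p F4 set" where
  "sphere4 j = {x. Q4 x = j}"

text \<open>\<open>L\<^sup>2\<close> norms for counting measure and for the uniform probability measure on a finite set.\<close>

definition L2_counting :: "'a set \<Rightarrow> ('a \<Rightarrow> complex) \<Rightarrow> real" where
  "L2_counting E g = sqrt (\<Sum>x\<in>E. (cmod (g x))\<^sup>2)"

definition L2_uniform :: "'a set \<Rightarrow> ('a \<Rightarrow> complex) \<Rightarrow> real" where
  "L2_uniform S f = sqrt (1 / real (card S) * (\<Sum>\<xi>\<in>S. (cmod (f \<xi>))\<^sup>2))"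

text \<open>
  The extension operator \<open>(f d\<sigma>)\<^sup>\<or>\<close>. A function on \<open>S\<close> is represented by a total function,
  of which only the values on \<open>S\<close> are used here and in \<open>L2_uniform\<close>.
\<close>

definition extension :: "'p::prime_card F4 set \<Rightarrow> ('p F4 \<Rightarrow> complex) \<Rightarrow> 'p F4 \<Rightarrow> complex" where
  "extension S f x = 1 / of_nat (card S) * (\<Sum>y\<in>S. f y * chi (dotp y x))"

definition Lambda :: "'p::prime_card F4 set \<Rightarrow> real \<Rightarrow> real" where
  "Lambda S \<theta> = Inf {\<kappa>. 0 \<le> \<kappa> \<and>
     (\<forall>E :: 'p F4 set. 1 \<le> card E \<and> real (card E) \<le> real CARD('p) powr \<theta> \<longrightarrow>
       (\<forall>f :: 'p F4 \<Rightarrow> complex.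
          L2_counting E (extension S f) \<le> real CARD('p) powr \<kappa> * L2_uniform S f))}"

definition Lambda_flat :: "real \<Rightarrow> real" where
  "Lambda_flat \<theta> = (if \<theta> < 2 then 0 else if \<theta> \<le> 3 then (\<theta> - 2) / 2 else 1 / 2)"

end

theory Submission
  imports Defs
begin

text \<open>
  The lower bound is attained on the single sphere \<open>j = 1\<close>, by an isotropic line. Since \<open>-1\<close> is a
  sum of two squares \<open>a\<^sup>2 + b\<^sup>2\<close> in the field with \<open>p\<close> elements, the direction \<open>v = (a, b, 1, 0)\<close> is
  isotropic. It is orthogonal to \<open>e = (0, 0, 0, 1)\<close>, so the whole line \<open>L = e + \<langle>v\<rangle>\<close> lies on the
  sphere \<open>S\<close> of radius one. For \<open>x\<close> in the hyperplane \<open>H = v\<^sup>\<bottom>\<close> the phase \<open>y \<cdot> x\<close> does not depend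
  on \<open>y \<in> L\<close>, so the extension of the indicator function of \<open>L\<close> has no cancellation there and has
  modulus \<open>p / |S|\<close>. For any \<open>E \<subseteq> H\<close> the squared ratio of the two norms is therefore exactly
  \<open>|E| p / |S|\<close>.

  An exponent statement for a single fixed \<open>p\<close> leaves no room for constants, and two roundings have
  to be controlled: \<open>|S|\<close> is not \<open>p\<^sup>3\<close>, and \<open>|E|\<close> must be an integer, say \<open>\<lfloor>p\<^sup>\<tau>\<rfloor>\<close> with
  \<open>\<tau> = min \<theta> 3\<close>. The first one saves the second: in four variables the form is a sum of two hyperbolic
  planes, so \<open>|S| \<le> p\<^sup>3 - p\<close> (\<open>card_unit_sphere_le\<close>), and the gain of the factor \<open>1 - p\<^sup>-\<^sup>2\<close> is worth
  at least one unit of \<open>p\<^sup>\<tau>\<close> as soon as \<open>\<tau> \<ge> 2\<close>. Capping \<open>\<tau>\<close> at \<open>3\<close>, the dimension of \<open>H\<close>, gives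
  the last case of \<open>Lambda_flat\<close> together with the middle one.

  Since \<open>Lambda\<close> is an infimum of reals, this bound on every admissible exponent is a bound on
  \<open>Lambda\<close> only because some exponent is admissible; Cauchy-Schwarz shows this for \<open>\<theta> / 2\<close>.
\<close>

section \<open>The quadratic form in four variables\<close>

lemma two_neq_zero_mod_ring:
  assumes "odd CARD('p::prime_card)"
  shows "(2 :: 'p mod_ring) \<noteq> 0"
proof
  assume "(2 :: 'p mod_ring) = 0"
  then have "of_nat 2 = (0 :: 'p mod_ring)" by simp
  then have "CARD('p) dvd 2" by (rule of_nat_0_mod_ring_dvd)
  then have "CARD('p) \<le> 2" by (rule dvd_imp_le) simp
  moreover have "CARD('p) > 1" by (rule nontriv)
  ultimately have "CARD('p) = 2" by simp
  then show False using assms by simp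
qed

text \<open>
  Pigeonhole: at least half of the field elements are squares. If no square had the form
  \<open>-1 - b\<^sup>2\<close>, the squares and their reflections would fill the field in two equal parts, which is
  impossible for odd \<open>p\<close>.
\<close>
lemma minus_one_sum_two_squares:
  assumes "odd CARD('p::prime_card)"
  obtains a b :: "'p::prime_card mod_ring" where "a\<^sup>2 + b\<^sup>2 = -1"
proof -
  define A where "A = range (\<lambda>x :: 'p mod_ring. x\<^sup>2)"
  define B where "B = (\<lambda>y. -1 - y) ` A"
  have fibre: "card {x :: 'p mod_ring. x\<^sup>2 = y} \<le> 2" if "y \<in> A" for y
  proof -
    from that obtain z where z: "y = z\<^sup>2" by (auto simp: A_def)
    have "{x. x\<^sup>2 = y} \<subseteq> {z, -z}" by (auto simp: z power2_eq_iff)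
    then have "card {x. x\<^sup>2 = y} \<le> card {z, -z}" by (intro card_mono) auto
    also have "\<dots> \<le> 2" by (simp add: card_insert_if)
    finally show ?thesis .
  qed
  have "A \<inter> B \<noteq> {}"
  proof
    assume disj: "A \<inter> B = {}"
    have "(UNIV :: 'p mod_ring set) = (\<Union>y\<in>A. {x. x\<^sup>2 = y})" by (auto simp: A_def)
    then have "CARD('p) = card (\<Union>y\<in>A. {x :: 'p mod_ring. x\<^sup>2 = y})" by simp
    also have "\<dots> \<le> (\<Sum>y\<in>A. card {x :: 'p mod_ring. x\<^sup>2 = y})" by (rule card_UN_le) simp
    also have "\<dots> \<le> card A * 2" using sum_bounded_above[OF fibre, of A] by simp
    finally have lower: "CARD('p) \<le> card A * 2" .
    have "card B = card A" unfolding B_def by (intro card_image inj_onI) simp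
    then have "card A * 2 = card (A \<union> B)" using disj by (simp add: card_Un_disjoint)
    also have "\<dots> \<le> card (UNIV :: 'p mod_ring set)" by (intro card_mono) auto
    finally have "CARD('p) = card A * 2" using lower by simp
    then show False using assms by simp
  qed
  then obtain a b :: "'p mod_ring" where "a\<^sup>2 = -1 - b\<^sup>2" by (auto simp: A_def B_def)
  then show thesis by (intro that[of a b]) (simp add: algebra_simps)
qed

lemma F4_eq_iff: "x = y \<longleftrightarrow> x$1 = y$1 \<and> x$2 = y$2 \<and> x$3 = y$3 \<and> x$4 = y$4" for x y :: "'a^4"
  by (simp add: vec_eq_iff forall_4)

text \<open>
  If \<open>a\<^sup>2 + b\<^sup>2 = -1\<close>, then mapping the quaternion units \<open>i\<close> and \<open>j\<close> to the matrices
  \<open>(0 1 | -1 0)\<close> and \<open>(a b | b -a)\<close> identifies the quaternions with the matrices of order two and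
  the norm \<open>Q4\<close> with the determinant. The unit sphere thus becomes the group \<open>SL\<^sub>2\<close>: a matrix in it
  has a nonzero first row \<open>(\<alpha>, \<beta>)\<close>, and given that row, one entry of the second row below a
  nonzero entry of the first row determines the other.
\<close>
lemma card_unit_sphere_le:
  assumes odd: "odd CARD('p::prime_card)"
  shows "card (sphere4 (1 :: 'p mod_ring)) \<le> (CARD('p)\<^sup>2 - 1) * CARD('p)"
proof -
  obtain a b :: "'p mod_ring" where ab: "a\<^sup>2 + b\<^sup>2 = -1"
    using minus_one_sum_two_squares[OF odd] by blast
  note two = two_neq_zero_mod_ring[OF odd]
  define \<alpha> where "\<alpha> x = x$1 + (a * x$3 + b * x$4)" for x :: "'p F4"
  define \<beta> where "\<beta> x = x$2 + (b * x$3 - a * x$4)" for x :: "'p F4"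
  define \<gamma> where "\<gamma> x = - x$2 + (b * x$3 - a * x$4)" for x :: "'p F4"
  define \<delta> where "\<delta> x = x$1 - (a * x$3 + b * x$4)" for x :: "'p F4"
  have det: "\<alpha> x * \<delta> x - \<beta> x * \<gamma> x = Q4 x" for x
  proof -
    have "\<alpha> x * \<delta> x - \<beta> x * \<gamma> x
        = (x$1)\<^sup>2 + (x$2)\<^sup>2 - (a\<^sup>2 + b\<^sup>2) * ((x$3)\<^sup>2 + (x$4)\<^sup>2)"
      by (simp add: \<alpha>_def \<beta>_def \<gamma>_def \<delta>_def power2_eq_square algebra_simps)
    then show ?thesis by (simp add: ab Q4_def sum_4)
  qed
  have entries_inj: "x = y"
    if eqs: "\<alpha> x = \<alpha> y" "\<beta> x = \<beta> y" "\<gamma> x = \<gamma> y" "\<delta> x = \<delta> y" for x y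
  proof -
    define u where "u z = a * z$3 + b * z$4" for z :: "'p F4"
    define w where "w z = b * z$3 - a * z$4" for z :: "'p F4"
    have "2 * x$1 = \<alpha> x + \<delta> x" "2 * x$2 = \<beta> x - \<gamma> x"
         "2 * u x = \<alpha> x - \<delta> x" "2 * w x = \<beta> x + \<gamma> x"
         "2 * y$1 = \<alpha> y + \<delta> y" "2 * y$2 = \<beta> y - \<gamma> y"
         "2 * u y = \<alpha> y - \<delta> y" "2 * w y = \<beta> y + \<gamma> y"
      by (simp_all add: \<alpha>_def \<beta>_def \<gamma>_def \<delta>_def u_def w_def algebra_simps)
    then have "2 * x$1 = 2 * y$1" "2 * x$2 = 2 * y$2" "2 * u x = 2 * u y" "2 * w x = 2 * w y"
      using eqs by simp_all
    then have 12: "x$1 = y$1" "x$2 = y$2" and uw: "u x = u y" "w x = w y"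
      using two by simp_all
    \<comment> \<open>The matrix taking the last two coordinates to \<open>(u, w)\<close> is the image of \<open>j\<close>; its square is
      \<open>-1\<close>, so it is inverted by applying it once more and changing the sign.\<close>
    have "a * u z + b * w z = (a\<^sup>2 + b\<^sup>2) * z$3" "b * u z - a * w z = (a\<^sup>2 + b\<^sup>2) * z$4" for z
      by (simp_all add: u_def w_def power2_eq_square algebra_simps)
    then have "z$3 = - (a * u z + b * w z)" "z$4 = - (b * u z - a * w z)" for z
      by (simp_all add: ab)
    then show ?thesis using 12 uw by (simp add: F4_eq_iff)
  qed
  define \<phi> where "\<phi> x = ((\<alpha> x, \<beta> x), if \<alpha> x \<noteq> 0 then \<gamma> x else \<delta> x)" for x
  define T where "T = (UNIV - {(0 :: 'p mod_ring, 0 :: 'p mod_ring)}) \<times> (UNIV :: 'p mod_ring set)"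
  have "inj_on \<phi> (sphere4 1)"
  proof (rule inj_onI)
    fix x y assume "x \<in> sphere4 1" "y \<in> sphere4 1" and eq: "\<phi> x = \<phi> y"
    then have dx: "\<alpha> x * \<delta> x - \<beta> x * \<gamma> x = 1" and dy: "\<alpha> y * \<delta> y - \<beta> y * \<gamma> y = 1"
      by (simp_all add: det sphere4_def)
    from eq have row: "\<alpha> x = \<alpha> y" "\<beta> x = \<beta> y" by (simp_all add: \<phi>_def)
    show "x = y"
    proof (cases "\<alpha> y = 0")
      case True
      then have \<delta>: "\<delta> x = \<delta> y" using eq row by (simp add: \<phi>_def)
      have "\<beta> y * \<gamma> x = \<beta> y * \<gamma> y" "\<beta> y \<noteq> 0"
        using True row dx dy by (auto simp: algebra_simps minus_equation_iff)
      then show ?thesis using \<delta> row by (intro entries_inj) simp_all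
    next
      case False
      then have \<gamma>: "\<gamma> x = \<gamma> y" using eq row by (simp add: \<phi>_def)
      have "\<alpha> y * \<delta> x = \<alpha> y * \<delta> y"
        using \<gamma> row dx dy by (simp add: diff_eq_eq)
      then show ?thesis using \<gamma> row False by (intro entries_inj) simp_all
    qed
  qed
  moreover have "\<phi> ` sphere4 1 \<subseteq> T"
    using det by (auto simp: \<phi>_def T_def sphere4_def) (metis diff_zero mult_zero_left zero_neq_one)+
  ultimately have "card (sphere4 (1 :: 'p mod_ring)) \<le> card T"
    by (intro card_inj_on_le) auto
  also have "card T = (CARD('p)\<^sup>2 - 1) * CARD('p)"
    by (simp add: T_def card_cartesian_product card_Diff_singleton power2_eq_square
        flip: UNIV_Times_UNIV)
  finally show ?thesis .
qed

section \<open>The extension operator\<close>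

lemma cmod_chi [simp]: "cmod (chi (y :: 'p::prime_card mod_ring)) = 1"
proof -
  have "chi y
      = exp (\<i> * of_real (2 * pi * of_int (to_int_mod_ring y) / real CARD('p)))"
    by (simp add: chi_def mult_ac)
  then show ?thesis by (simp add: norm_exp_i_times del: of_real_mult of_real_divide)
qed

lemma cmod_extension_le: "cmod (extension S f x) \<le> L2_uniform S f"
proof -
  have "(cmod (\<Sum>y\<in>S. f y * chi (dotp y x)))\<^sup>2 \<le> (\<Sum>y\<in>S. cmod (f y))\<^sup>2"
    by (intro power_mono order.trans[OF norm_sum]) (simp_all add: norm_mult)
  also have "\<dots> \<le> (\<Sum>y\<in>S. (cmod (f y))\<^sup>2) * card S"
    by (rule sum_squared_le_sum_of_squares)
  finally have "(cmod (\<Sum>y\<in>S. f y * chi (dotp y x)))\<^sup>2 / (card S)\<^sup>2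
      \<le> (\<Sum>y\<in>S. (cmod (f y))\<^sup>2) * card S / (card S)\<^sup>2"
    by (rule divide_right_mono) simp
  then have "(cmod (extension S f x))\<^sup>2 \<le> 1 / card S * (\<Sum>y\<in>S. (cmod (f y))\<^sup>2)"
    by (simp add: extension_def norm_mult norm_divide power_divide power2_eq_square
        split: if_splits)
  then show ?thesis unfolding L2_uniform_def by (rule real_le_rsqrt)
qed

text \<open>
  The infimum defining \<open>Lambda\<close> ranges over a nonempty set, as \<open>\<theta> / 2\<close> belongs to it by the trivial
  pointwise bound. Without this a lower bound for the admissible exponents would say nothing about
  the infimum.
\<close>
lemma Lambda_greatest:
  fixes S :: "'p::prime_card F4 set"
  assumes \<theta>: "0 \<le> \<theta>"
    and lower: "\<And>\<kappa>. 0 \<le> \<kappa> \<Longrightarrow>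
      (\<And>E f. 1 \<le> card E \<Longrightarrow> real (card E) \<le> real CARD('p) powr \<theta> \<Longrightarrow>
         L2_counting E (extension S f) \<le> real CARD('p) powr \<kappa> * L2_uniform S f) \<Longrightarrow> m \<le> \<kappa>"
  shows "m \<le> Lambda S \<theta>"
  unfolding Lambda_def
proof (rule cInf_greatest)
  have "L2_counting E (extension S f) \<le> real CARD('p) powr (\<theta> / 2) * L2_uniform S f"
    if E: "real (card E) \<le> real CARD('p) powr \<theta>" for E :: "'p F4 set" and f
  proof -
    have nonneg: "0 \<le> L2_uniform S f" by (simp add: L2_uniform_def sum_nonneg)
    have "(\<Sum>x\<in>E. (cmod (extension S f x))\<^sup>2) \<le> card E * (L2_uniform S f)\<^sup>2"
      by (rule sum_bounded_above) (intro power_mono cmod_extension_le, simp)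
    also have "\<dots> \<le> real CARD('p) powr \<theta> * (L2_uniform S f)\<^sup>2"
      using E by (intro mult_right_mono) simp_all
    also have "\<dots> = (real CARD('p) powr (\<theta> / 2) * L2_uniform S f)\<^sup>2"
      by (simp add: power_mult_distrib power2_eq_square flip: powr_add)
    finally show ?thesis
      unfolding L2_counting_def using nonneg by (intro real_le_lsqrt) auto
  qed
  then show "{\<kappa>. 0 \<le> \<kappa> \<and> (\<forall>E :: 'p F4 set. 1 \<le> card E \<and> real (card E) \<le> real CARD('p) powr \<theta> \<longrightarrow>
       (\<forall>f. L2_counting E (extension S f) \<le> real CARD('p) powr \<kappa> * L2_uniform S f))} \<noteq> {}"
    using \<theta> by (auto intro!: exI[of _ "\<theta> / 2"])
qed (use lower in blast)

lemma L2_uniform_indicator: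
  assumes "finite S" "L \<subseteq> S"
  shows "L2_uniform S (indicator L) = sqrt (card L / card S)"
proof -
  have "(\<Sum>y\<in>S. (cmod (indicator L y))\<^sup>2) = (\<Sum>y\<in>S. indicator L y)"
    by (intro sum.cong) (auto simp: indicator_def)
  also have "\<dots> = (\<Sum>y\<in>L. 1)"
    using assms by (intro sum.mono_neutral_cong_right) auto
  finally show ?thesis by (simp add: L2_uniform_def)
qed

lemma L2_counting_extension_indicator:
  fixes S :: "'p::prime_card F4 set"
  assumes "L \<subseteq> S" and const: "\<And>x y. x \<in> E \<Longrightarrow> y \<in> L \<Longrightarrow> dotp y x = c x"
  shows "L2_counting E (extension S (indicator L)) = sqrt (card E) * (card L / card S)"
proof -
  have "cmod (extension S (indicator L) x) = card L / card S" if "x \<in> E" for x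
  proof -
    have "(\<Sum>y\<in>S. indicator L y * chi (dotp y x)) = (\<Sum>y\<in>L. chi (dotp y x))"
      using assms(1) by (intro sum.mono_neutral_cong_right) auto
    also have "\<dots> = of_nat (card L) * chi (c x)"
      using that by (simp add: const)
    finally show ?thesis by (simp add: extension_def norm_mult norm_divide)
  qed
  then have "(\<Sum>x\<in>E. (cmod (extension S (indicator L) x))\<^sup>2) = card E * (card L / card S)\<^sup>2"
    by simp
  then show ?thesis
    by (simp add: L2_counting_def real_sqrt_mult del: power_divide)
qed

section \<open>The isotropic line\<close>

lemma isotropic_line_and_hyperplane:
  assumes odd: "odd CARD('p::prime_card)"
  obtains L H :: "'p::prime_card F4 set" and c where "L \<subseteq> sphere4 1" "card L = CARD('p)"
    "card H = CARD('p) ^ 3" "\<And>x y. x \<in> H \<Longrightarrow> y \<in> L \<Longrightarrow> dotp y x = c x"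
proof -
  obtain a b :: "'p mod_ring" where ab: "a\<^sup>2 + b\<^sup>2 = -1"
    using minus_one_sum_two_squares[OF odd] by blast
  define quad :: "'p mod_ring \<Rightarrow> 'p mod_ring \<Rightarrow> 'p mod_ring \<Rightarrow> 'p mod_ring \<Rightarrow> 'p F4"
    where "quad r s t u = (\<chi> i. if i = 1 then r else if i = 2 then s else if i = 3 then t else u)"
    for r s t u
  have [simp]: "quad r s t u $ 1 = r" "quad r s t u $ 2 = s"
    "quad r s t u $ 3 = t" "quad r s t u $ 4 = u" for r s t u
    by (simp_all add: quad_def)
  define L where "L = range (\<lambda>t. quad (t * a) (t * b) t 1)"
  define H where "H = range (\<lambda>(r, s, u). quad r s (- (r * a + s * b)) u)"
  show thesis
  proof
    have "Q4 (quad (t * a) (t * b) t 1) = t\<^sup>2 * (a\<^sup>2 + b\<^sup>2) + t\<^sup>2 + 1" for t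
      by (simp add: Q4_def sum_4 power_mult_distrib algebra_simps)
    then show "L \<subseteq> sphere4 1" by (auto simp: L_def sphere4_def ab)
    have "inj (\<lambda>t. quad (t * a) (t * b) t 1)" by (rule injI) (simp add: F4_eq_iff)
    then show "card L = CARD('p)" by (simp add: L_def card_image)
    have "inj (\<lambda>(r, s, u). quad r s (- (r * a + s * b)) u)"
      by (rule injI) (auto simp: F4_eq_iff)
    then have "card H = CARD('p mod_ring \<times> 'p mod_ring \<times> 'p mod_ring)"
      unfolding H_def by (rule card_image)
    also have "\<dots> = CARD('p) ^ 3" by (simp add: power3_eq_cube)
    finally show "card H = CARD('p) ^ 3" .
    show "dotp y x = x $ 4" if "x \<in> H" "y \<in> L" for x y
      using that by (auto simp: H_def L_def dotp_def sum_4 algebra_simps)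
  qed
qed

text \<open>
  The arithmetic of the two roundings, for \<open>P = p\<^sup>\<tau>\<close>, \<open>N = \<lfloor>P\<rfloor>\<close> and \<open>s = |S|\<close>: the loss \<open>P - N < 1\<close> is
  multiplied by \<open>p\<^sup>2\<close>, and the deficit of \<open>s\<close> from \<open>p\<^sup>3\<close> gains \<open>P \<ge> p\<^sup>2\<close>.
\<close>
lemma rounding_absorbed:
  fixes p P N s :: real
  assumes "0 < p" "0 < s" "s \<le> (p\<^sup>2 - 1) * p" "p\<^sup>2 \<le> P" "P - 1 \<le> N"
  shows "P / p\<^sup>2 \<le> N * (p / s)"
proof -
  have "P * s \<le> P * ((p\<^sup>2 - 1) * p)"
    using assms by (intro mult_left_mono) (auto intro: order.trans[OF zero_le_power2])
  also have "\<dots> = (P * p\<^sup>2 - P) * p" by (simp add: algebra_simps)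
  also have "\<dots> \<le> (P * p\<^sup>2 - p\<^sup>2) * p" using assms by (intro mult_right_mono) simp_all
  also have "\<dots> = (P - 1) * p\<^sup>2 * p" by (simp add: algebra_simps)
  also have "\<dots> \<le> N * p\<^sup>2 * p" using assms by (intro mult_right_mono) simp_all
  finally have "P * s \<le> N * p * p\<^sup>2" by (simp add: mult_ac)
  then show ?thesis using assms by (simp add: divide_simps)
qed

text \<open>
  Sets \<open>E\<close> of size about \<open>p\<^sup>\<tau>\<close> in the hyperplane test all \<open>\<theta> \<ge> \<tau>\<close>, so \<open>\<tau>\<close> is a free parameter; it
  is limited by the size \<open>p\<^sup>3\<close> of the hyperplane.
\<close>
lemma Lambda_unit_sphere_ge:
  assumes odd: "odd CARD('p::prime_card)" and \<tau>: "2 \<le> \<tau>" "\<tau> \<le> 3" "\<tau> \<le> \<theta>"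
  shows "(\<tau> - 2) / 2 \<le> Lambda (sphere4 (1 :: 'p mod_ring)) \<theta>"
proof (rule Lambda_greatest)
  show "0 \<le> \<theta>" using \<tau> by simp
next
  fix \<kappa>
  assume bound: "\<And>E f. 1 \<le> card E \<Longrightarrow> real (card E) \<le> real CARD('p) powr \<theta> \<Longrightarrow>
    L2_counting E (extension (sphere4 (1 :: 'p mod_ring)) f)
      \<le> real CARD('p) powr \<kappa> * L2_uniform (sphere4 1) f"
  define p where "p = real CARD('p)"
  define S where "S = sphere4 (1 :: 'p mod_ring)"
  define s where "s = real (card S)"
  define N where "N = nat \<lfloor>p powr \<tau>\<rfloor>"
  have p: "1 < p" using nontriv[where 'a = 'p] by (simp add: p_def)
  obtain L H :: "'p F4 set" and c where LH: "L \<subseteq> S" "card L = CARD('p)" "card H = CARD('p) ^ 3"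
    and phase: "\<And>x y. x \<in> H \<Longrightarrow> y \<in> L \<Longrightarrow> dotp y x = c x"
    using isotropic_line_and_hyperplane[OF odd] unfolding S_def by metis
  have "card L \<le> card S" using LH by (intro card_mono) auto
  then have s_pos: "0 < s" using LH p by (simp add: s_def p_def)
  have "s \<le> real ((CARD('p)\<^sup>2 - 1) * CARD('p))"
    unfolding s_def S_def using card_unit_sphere_le[OF odd] of_nat_le_iff by blast
  also have "\<dots> = (p\<^sup>2 - 1) * p" by (simp add: p_def of_nat_diff)
  finally have s_le: "s \<le> (p\<^sup>2 - 1) * p" .
  have "p powr 2 \<le> p powr \<tau>" using p \<tau> by (intro powr_mono) auto
  then have P_ge: "p\<^sup>2 \<le> p powr \<tau>" using p by simp
  have N: "p powr \<tau> - 1 \<le> real N" "real N \<le> p powr \<tau>"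
    unfolding N_def by simp_all
  have "p powr \<tau> \<le> p powr 3" using p \<tau> by (intro powr_mono) auto
  then have "real N \<le> p ^ 3" using N p by simp
  then have "N \<le> card H" unfolding LH p_def by (simp flip: of_nat_power)
  then obtain E where E: "E \<subseteq> H" "card E = N" using obtain_subset_with_card_n by metis
  have "1 < p\<^sup>2" using p by simp
  then have "0 < N" using P_ge N by linarith
  moreover have "p powr \<tau> \<le> p powr \<theta>" using p \<tau> by (intro powr_mono) auto
  ultimately have "L2_counting E (extension S (indicator L)) \<le> p powr \<kappa> * L2_uniform S (indicator L)"
    using bound[of E "indicator L"] N E by (simp add: S_def p_def)
  moreover have "L2_counting E (extension S (indicator L)) = sqrt N * (p / s)"
    using L2_counting_extension_indicator[of L S E c] LH phase E by (auto simp: p_def s_def)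
  moreover have "L2_uniform S (indicator L) = sqrt (p / s)"
    using L2_uniform_indicator[of S L] LH by (simp add: p_def s_def)
  ultimately have "sqrt N * (p / s) \<le> p powr \<kappa> * sqrt (p / s)"
    by simp
  moreover have "p / s = sqrt (p / s) * sqrt (p / s)" and r_pos: "0 < sqrt (p / s)"
    using p s_pos by simp_all
  ultimately have "sqrt N * sqrt (p / s) * sqrt (p / s) \<le> p powr \<kappa> * sqrt (p / s)"
    by (metis mult.assoc)
  then have "sqrt N * sqrt (p / s) \<le> p powr \<kappa>"
    using r_pos by (rule mult_right_le_imp_le)
  then have "(sqrt (N * (p / s)))\<^sup>2 \<le> (p powr \<kappa>)\<^sup>2"
    using p s_pos by (intro power_mono) (simp_all add: real_sqrt_mult real_sqrt_divide)
  then have "N * (p / s) \<le> p powr (2 * \<kappa>)"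
    using p s_pos by (simp add: power2_eq_square flip: powr_add)
  moreover have "p powr (\<tau> - 2) = p powr \<tau> / p\<^sup>2"
    using p by (simp add: powr_diff)
  moreover have "p powr \<tau> / p\<^sup>2 \<le> N * (p / s)"
    using rounding_absorbed[OF _ s_pos s_le P_ge N(1)] p by simp
  ultimately have "p powr (\<tau> - 2) \<le> p powr (2 * \<kappa>)" by simp
  then show "(\<tau> - 2) / 2 \<le> \<kappa>" using p by simp
qed

theorem proposition8p3:
  fixes \<theta> :: real
  assumes "odd CARD('p::prime_card)"
    and "0 \<le> \<theta>" and "\<theta> \<le> 4"
  shows "(SUP j \<in> {j :: 'p mod_ring. j \<noteq> 0}. Lambda (sphere4 j) \<theta>) \<ge> Lambda_flat \<theta>"
proof -
  have "Lambda_flat \<theta> \<le> Lambda (sphere4 (1 :: 'p mod_ring)) \<theta>"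
  proof (cases "\<theta> < 2")
    case True
    then show ?thesis using assms by (auto simp: Lambda_flat_def intro: Lambda_greatest)
  next
    case False
    then have "Lambda_flat \<theta> = (min \<theta> 3 - 2) / 2" by (simp add: Lambda_flat_def)
    then show ?thesis using Lambda_unit_sphere_ge[OF assms(1), of "min \<theta> 3" \<theta>] False by simp
  qed
  also have "\<dots> \<le> (SUP j \<in> {j :: 'p mod_ring. j \<noteq> 0}. Lambda (sphere4 j) \<theta>)"
    by (rule cSUP_upper) simp_all
  finally show ?thesis .
qed

end
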